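(* For every $n\ge 0$, the number $N_{ST}(n)$ of spanning trees of the pseudofractal scale-free web $G(n)$ is $$N_{ST}(n)=2^{\frac{3^{n+1}-2n-3}{4}}\;3^{\frac{3^{n+1}+2n+1}{4}}.$$
   Context: Pseudofractal scale-free web: $G(0)$ is a triangle. For $n\ge1$, $G(n)$ is obtained from $G(n-1)$ by adding, for every edge of $G(n-1)$, one new vertex joined by new edges to both endpoints of that edge (the old edges are kept). A spanning tree of a graph $G$ is a subgraph with the same vertex set as $G$ which is a tree. *)

theory Defs
  imports Complex_Main "HOL-Library.FSet"
begin

text \<open>
  Finite simple undirected graphs are pairs of a vertex set and a set of two-element edges.
  The predicates \<open>tree\<close> and \<open>spanning_tree\<close> of the AFP entry Graph-Theory are not used: they
  forbid directed cycles only, and in a symmetric digraph every edge already yields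
  a directed cycle of length two.
\<close>

type_synonym 'a ugraph = "'a set \<times> 'a set set"

abbreviation verts :: "'a ugraph \<Rightarrow> 'a set" where "verts G \<equiv> fst G"

abbreviation edges :: "'a ugraph \<Rightarrow> 'a set set" where "edges G \<equiv> snd G"

definition is_graph :: "'a ugraph \<Rightarrow> bool" where
  "is_graph G \<longleftrightarrow> finite (verts G) \<and>
     (\<forall>e \<in> edges G. \<exists>u \<in> verts G. \<exists>v \<in> verts G. u \<noteq> v \<and> e = {u, v})"

definition subgraph :: "'a ugraph \<Rightarrow> 'a ugraph \<Rightarrow> bool" where
  "subgraph H G \<longleftrightarrow> is_graph H \<and> is_graph G \<and> verts H \<subseteq> verts G \<and> edges H \<subseteq> edges G"

definition connected_graph :: "'a ugraph \<Rightarrow> bool" where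
  "connected_graph G \<longleftrightarrow> verts G \<noteq> {} \<and>
     (\<forall>u \<in> verts G. \<forall>v \<in> verts G. (u, v) \<in> {(x, y). {x, y} \<in> edges G}\<^sup>*)"

definition graph_cycle :: "'a ugraph \<Rightarrow> 'a list \<Rightarrow> bool" where
  "graph_cycle G xs \<longleftrightarrow> 3 \<le> length xs \<and> distinct xs \<and>
     (\<forall>i < length xs. {xs ! i, xs ! (Suc i mod length xs)} \<in> edges G)"

definition tree :: "'a ugraph \<Rightarrow> bool" where
  "tree G \<longleftrightarrow> is_graph G \<and> connected_graph G \<and> \<not> (\<exists>xs. graph_cycle G xs)"

definition spanning_tree :: "'a ugraph \<Rightarrow> 'a ugraph \<Rightarrow> bool" where
  "spanning_tree T G \<longleftrightarrow> subgraph T G \<and> verts T = verts G \<and> tree T"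

definition num_spanning_trees :: "'a ugraph \<Rightarrow> nat" where
  "num_spanning_trees G = card {T. spanning_tree T G}"

text \<open>
  \<open>New n {|u, v|}\<close> is the vertex created for the edge \<open>{u, v}\<close> in the step from the \<open>n\<close>-th graph
  to its successor. The index is needed because edges are kept, so that an edge receives
  a further new vertex in every later step.
\<close>

datatype vertex = TriA | TriB | TriC | New nat "vertex fset"

primrec pseudofractal :: "nat \<Rightarrow> vertex ugraph" where
  "pseudofractal 0 = ({TriA, TriB, TriC}, {{TriA, TriB}, {TriB, TriC}, {TriA, TriC}})"
| "pseudofractal (Suc n) =
    (verts (pseudofractal n) \<union>
       {New n {|u, v|} | u v. {u, v} \<in> edges (pseudofractal n)},
     edges (pseudofractal n) \<union>
       {{u, New n {|u, v|}} | u v. {u, v} \<in> edges (pseudofractal n)})"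

text \<open>
  Both endpoints of \<open>{u, v}\<close> are joined to the new vertex, since \<open>u\<close> and \<open>v\<close> may be exchanged
  in the last comprehension. The vertices added are indeed new:
\<close>

lemma New_level_less: "New k e \<in> verts (pseudofractal n) \<Longrightarrow> k < n"
  by (induction n) auto

lemma New_fresh: "New n e \<notin> verts (pseudofractal n)"
  using New_level_less[of n e n] by auto

lemma edges_in_verts:
  assumes "is_graph G" "{u, v} \<in> edges G"
  shows "u \<in> verts G" "v \<in> verts G"
proof -
  obtain x y where "x \<in> verts G" "y \<in> verts G" "{u, v} = {x, y}"
    using assms unfolding is_graph_def by blast
  then show "u \<in> verts G" "v \<in> verts G" by (auto simp: doubleton_eq_iff)
qed

lemma is_graph_pseudofractal: "is_graph (pseudofractal n)"
proof (induction n)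
  case 0
  show ?case by (simp add: is_graph_def)
next
  case (Suc n)
  let ?V = "verts (pseudofractal n)" and ?E = "edges (pseudofractal n)"
  let ?N = "{New n {|u, v|} | u v. {u, v} \<in> ?E}"
  have fin: "finite ?V"
    using Suc by (simp add: is_graph_def)
  have "?N \<subseteq> (\<lambda>(u, v). New n {|u, v|}) ` (?V \<times> ?V)"
    using edges_in_verts[OF Suc] by (auto intro: rev_image_eqI)
  then have finN: "finite ?N"
    by (rule finite_subset) (simp add: fin)
  show ?case
    unfolding is_graph_def pseudofractal.simps fst_conv snd_conv
  proof (intro conjI ballI)
    show "finite (?V \<union> ?N)" using fin finN by simp
  next
    fix e assume "e \<in> ?E \<union> {{u, New n {|u, v|}} | u v. {u, v} \<in> ?E}"
    then consider "e \<in> ?E" | u v where "{u, v} \<in> ?E" "e = {u, New n {|u, v|}}"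
      by auto
    then show "\<exists>u \<in> ?V \<union> ?N. \<exists>v \<in> ?V \<union> ?N. u \<noteq> v \<and> e = {u, v}"
    proof cases
      case 1
      then have "\<exists>u \<in> ?V. \<exists>v \<in> ?V. u \<noteq> v \<and> e = {u, v}"
        using Suc unfolding is_graph_def by (elim conjE) (rule bspec)
      then show ?thesis by (meson UnI1)
    next
      case (2 u v)
      have u: "u \<in> ?V" by (rule edges_in_verts(1)[OF Suc 2(1)])
      have w: "New n {|u, v|} \<in> ?N" using 2(1) by auto
      have "u \<noteq> New n {|u, v|}" using u New_fresh[of n "{|u, v|}"] by auto
      then show ?thesis
        by (intro bexI[OF _ UnI1[OF u]] bexI[OF _ UnI2[OF w]] conjI 2(2))
    qed
  qed
qed

end

theory Submission
  imports Defs "HOL-Library.FuncSet"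
begin

text \<open>
  A connected graph \<open>(V, E)\<close> is a tree iff \<open>|E| + 1 = |V|\<close>. Let \<open>(V', E')\<close> arise from
  \<open>(V, E)\<close> by erecting a triangle with a new apex on every edge, and send a set \<open>F \<subseteq> E'\<close> to the
  set \<open>project F\<close> of those \<open>e \<in> E\<close> whose endpoints are joined by \<open>F\<close> within the triangle on \<open>e\<close>.
  Then \<open>F\<close> is connected iff \<open>project F\<close> is and no apex is isolated, and counting edges shows that
  \<open>F\<close> is a spanning tree iff moreover \<open>project F\<close> is one and \<open>F\<close> contains no whole triangle. Over
  a spanning tree of \<open>(V, E)\<close> each of its \<open>|V| - 1\<close> edges then leaves 3 choices in its triangle and
  each of the other edges leaves 2, so the number of spanning trees is multiplied by
  \<open>3 ^ (|V| - 1) * 2 ^ (|E| - |V| + 1)\<close>.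
\<close>

section \<open>Reachability, cycles and edge counts in finite graphs\<close>

abbreviation adj :: "'a set set \<Rightarrow> ('a \<times> 'a) set" where
  "adj F \<equiv> {(x, y). {x, y} \<in> F}"

lemma adj_rtrancl_sym: "(x, y) \<in> (adj F)\<^sup>* \<Longrightarrow> (y, x) \<in> (adj F)\<^sup>*"
proof -
  have "sym (adj F)" by (auto simp: sym_def insert_commute)
  then show "(x, y) \<in> (adj F)\<^sup>* \<Longrightarrow> (y, x) \<in> (adj F)\<^sup>*"
    by (meson sym_rtrancl symD)
qed

lemma adj_rtrancl_mono: "F \<subseteq> F' \<Longrightarrow> (x, y) \<in> (adj F)\<^sup>* \<Longrightarrow> (x, y) \<in> (adj F')\<^sup>*"
  by (rule rtrancl_mono[THEN subsetD]) auto

lemma connected_graphI: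
  assumes "r \<in> V" "\<And>v. v \<in> V \<Longrightarrow> (r, v) \<in> (adj F)\<^sup>*"
  shows "connected_graph (V, F)"
  unfolding connected_graph_def
  using assms by (auto intro: rtrancl_trans adj_rtrancl_sym)

lemma connected_graphD:
  assumes "connected_graph (V, F)" "u \<in> V" "v \<in> V"
  shows "(u, v) \<in> (adj F)\<^sup>*"
  using assms unfolding connected_graph_def by auto

text \<open>Every step of a walk in \<open>F\<close> can be replaced by a walk in \<open>F'\<close>.
  This is the common tool for deleting a redundant edge and for passing from
  \<open>project F\<close> to \<open>F\<close>.\<close>

lemma connected_graph_transfer:
  assumes "connected_graph (V, F)" "\<And>x y. {x, y} \<in> F \<Longrightarrow> (x, y) \<in> (adj F')\<^sup>*"
  shows "connected_graph (V, F')"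
proof -
  have "(adj F)\<^sup>* \<subseteq> (adj F')\<^sup>*"
    using assms(2) by (intro rtrancl_subset_rtrancl) auto
  then show ?thesis
    using assms(1) unfolding connected_graph_def by auto
qed

lemma is_graph_subset: "is_graph (V, E) \<Longrightarrow> F \<subseteq> E \<Longrightarrow> is_graph (V, F)"
  unfolding is_graph_def by (auto dest: subsetD)

lemma is_graph_finite_edges:
  assumes "is_graph (V, E)"
  shows "finite E"
proof (rule finite_subset)
  show "E \<subseteq> Pow V" using assms unfolding is_graph_def by fastforce
  show "finite (Pow V)" using assms unfolding is_graph_def by simp
qed

lemma is_graph_edgeE:
  assumes "is_graph (V, E)" "e \<in> E"
  obtains u v where "u \<in> V" "v \<in> V" "u \<noteq> v" "e = {u, v}"
  using assms unfolding is_graph_def by auto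

lemma distinct_path:
  assumes "(u, v) \<in> (adj F)\<^sup>*"
  shows "\<exists>xs. xs \<noteq> [] \<and> hd xs = u \<and> last xs = v \<and> distinct xs \<and>
    (\<forall>i. Suc i < length xs \<longrightarrow> {xs ! i, xs ! Suc i} \<in> F)"
  using assms
proof (induction rule: rtrancl_induct)
  case base
  show ?case by (intro exI[of _ "[u]"]) simp
next
  case (step y z)
  then obtain xs where xs: "xs \<noteq> []" "hd xs = u" "last xs = y" "distinct xs"
    "\<And>i. Suc i < length xs \<Longrightarrow> {xs ! i, xs ! Suc i} \<in> F" by auto
  show ?case
  proof (cases "z \<in> set xs")
    case True
    then obtain i where i: "i < length xs" "xs ! i = z"
      by (auto simp: in_set_conv_nth)
    \<comment> \<open>The walk has returned to a vertex already on the path, so the path is cut back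
      to its first part ending in \<open>z\<close>.\<close>
    have "last (take (Suc i) xs) = z"
      using i by (simp add: take_Suc_conv_app_nth)
    then show ?thesis using xs i
      by (intro exI[of _ "take (Suc i) xs"]) (auto simp: hd_take)
  next
    case False
    have "{(xs @ [z]) ! i, (xs @ [z]) ! Suc i} \<in> F" if "Suc i < length (xs @ [z])" for i
    proof (cases "Suc i < length xs")
      case True
      then show ?thesis using xs(5)[of i] by (simp add: nth_append)
    next
      case False
      then have "Suc i = length xs" using that by simp
      then have "length xs - 1 = i" "i < length xs" by auto
      then have "xs ! i = y" "i < length xs"
        using xs(1,3) by (auto simp: last_conv_nth)
      then show ?thesis using step(2) \<open>Suc i = length xs\<close> by (simp add: nth_append)
    qed
    then show ?thesis using xs False
      by (intro exI[of _ "xs @ [z]"]) auto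
  qed
qed

text \<open>A simple path in \<open>F\<close> from \<open>u\<close> to \<open>v\<close> is closed up
  by the edge \<open>{u, v}\<close>. The path has at least three vertices because \<open>u\<close>
  and \<open>v\<close> differ and \<open>{u, v}\<close> is not in \<open>F\<close>.\<close>

lemma chord_gives_cycle:
  assumes "is_graph (V, E)" "F \<subseteq> E" "{u, v} \<in> E - F" "(u, v) \<in> (adj F)\<^sup>*"
  shows "\<exists>xs. graph_cycle (V, E) xs"
proof -
  obtain xs where xs: "xs \<noteq> []" "hd xs = u" "last xs = v" "distinct xs"
    "\<And>i. Suc i < length xs \<Longrightarrow> {xs ! i, xs ! Suc i} \<in> F"
    using distinct_path[OF assms(4)] by auto
  have uv: "u \<noteq> v"
    using assms(1,3) by (auto elim!: is_graph_edgeE[of V E "{u, v}"])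
  have ends: "xs ! 0 = u" "xs ! (length xs - 1) = v"
    using xs by (auto simp: hd_conv_nth last_conv_nth)
  have "length xs \<noteq> 1" using uv ends by auto
  moreover have "length xs \<noteq> 2" using xs(5)[of 0] assms(3) ends by (auto simp: numeral_2_eq_2)
  moreover have "length xs \<noteq> 0" using xs(1) by simp
  ultimately have len: "3 \<le> length xs" by linarith
  have "{xs ! i, xs ! (Suc i mod length xs)} \<in> E" if "i < length xs" for i
  proof (cases "Suc i < length xs")
    case True
    then show ?thesis using xs(5)[of i] assms(2) by auto
  next
    case False
    then have "Suc i = length xs" using that by simp
    then have "i = length xs - 1" "Suc i mod length xs = 0" by auto
    then show ?thesis using ends assms(3) by (auto simp: insert_commute)
  qed
  then show ?thesis using len xs(4) unfolding graph_cycle_def by auto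
qed

text \<open>The rest of the cycle is a detour around its closing edge.\<close>

lemma cycle_edge_removable:
  assumes "connected_graph (V, E)" "graph_cycle (V, E) xs"
  shows "\<exists>e \<in> E. connected_graph (V, E - {e})"
proof -
  define m where "m = length xs - 1"
  have len: "length xs = Suc m" "m \<ge> 2" and dist: "distinct xs"
    and edge: "\<And>i. i < length xs \<Longrightarrow> {xs ! i, xs ! (Suc i mod length xs)} \<in> E"
    using assms(2) unfolding graph_cycle_def m_def by auto
  define e where "e = {xs ! m, xs ! 0}"
  have e: "e \<in> E" using edge[of m] len by (simp add: e_def)
  have path: "i \<le> m \<Longrightarrow> (xs ! 0, xs ! i) \<in> (adj (E - {e}))\<^sup>*" for i
  proof (induction i)
    case 0
    show ?case by simp
  next
    case (Suc i)
    have "{xs ! i, xs ! Suc i} \<in> E" using edge[of i] Suc(2) len by simp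
    \<comment> \<open>Here \<open>m \<ge> 2\<close> matters: on a list of two vertices the only path
      edge would be the closing edge itself.\<close>
    moreover have "{xs ! i, xs ! Suc i} \<noteq> e"
      using Suc(2) len dist unfolding e_def
      by (auto simp: doubleton_eq_iff nth_eq_iff_index_eq)
    ultimately show ?case using Suc by (auto intro: rtrancl_into_rtrancl)
  qed
  have "connected_graph (V, E - {e})"
  proof (rule connected_graph_transfer[OF assms(1)])
    fix x y assume xy: "{x, y} \<in> E"
    show "(x, y) \<in> (adj (E - {e}))\<^sup>*"
    proof (cases "{x, y} = e")
      case True
      then show ?thesis using path[of m] adj_rtrancl_sym[OF path[of m]]
        by (auto simp: e_def doubleton_eq_iff)
    next
      case False
      then show ?thesis using xy by auto
    qed
  qed
  then show ?thesis using e by blast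
qed

text \<open>Grow a tree from a root, adding one vertex and one edge at a time. Only connectivity and
  the edge count are recorded, since these two will later replace acyclicity.\<close>

lemma connected_spanning_subset:
  assumes "is_graph (V, E)" "connected_graph (V, E)"
  obtains F where "F \<subseteq> E" "connected_graph (V, F)" "card F + 1 = card V"
proof -
  have finV: "finite V" using assms(1) by (simp add: is_graph_def)
  have finE: "finite E" by (rule is_graph_finite_edges[OF assms(1)])
  obtain r where r: "r \<in> V" using assms(2) by (auto simp: connected_graph_def)
  \<comment> \<open>The invariant \<open>F \<subseteq> Pow S\<close> guarantees that an edge leaving
    \<open>S\<close> is not yet in \<open>F\<close>, so each extension adds exactly one
    edge.\<close>
  have grow: "\<exists>S F. S \<subseteq> V \<and> F \<subseteq> E \<and> F \<subseteq> Pow S \<and> r \<in> S \<and> card S = Suc k \<and> card F = k \<and>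
      (\<forall>x \<in> S. (r, x) \<in> (adj F)\<^sup>*)" if "k < card V" for k
    using that
  proof (induction k)
    case 0
    show ?case using r by (intro exI[of _ "{r}"] exI[of _ "{}"]) auto
  next
    case (Suc k)
    then obtain S F where SF: "S \<subseteq> V" "F \<subseteq> E" "F \<subseteq> Pow S" "r \<in> S" "card S = Suc k"
      "card F = k" "\<And>x. x \<in> S \<Longrightarrow> (r, x) \<in> (adj F)\<^sup>*" by auto
    have "S \<noteq> V" using SF(5) Suc(2) by auto
    then obtain t where t: "t \<in> V" "t \<notin> S" using SF(1) by auto
    have "(r, t) \<in> (adj E)\<^sup>*" using connected_graphD[OF assms(2) r t(1)] .
    \<comment> \<open>A walk that starts at \<open>r\<close> in \<open>S\<close> either is still in
      \<open>S\<close> or has crossed an edge leaving \<open>S\<close>.\<close>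
    then have "t \<in> S \<or> (\<exists>x y. x \<in> S \<and> y \<notin> S \<and> {x, y} \<in> E)"
      by (induction rule: rtrancl_induct) (use SF(4) in auto)
    then obtain x y where xy: "x \<in> S" "y \<notin> S" "{x, y} \<in> E" using t(2) by auto
    have y: "y \<in> V" using edges_in_verts(2)[OF assms(1)] xy(3) by simp
    have new: "{x, y} \<notin> F" using SF(3) xy(2) by auto
    have reach: "(r, z) \<in> (adj (insert {x, y} F))\<^sup>*" if "z \<in> S" for z
      using adj_rtrancl_mono[OF _ SF(7)[OF that]] by blast
    have "(r, y) \<in> (adj (insert {x, y} F))\<^sup>*"
      by (rule rtrancl_into_rtrancl[OF reach[OF xy(1)]]) simp
    moreover have "finite S" "finite F"
      using SF(1,2) finV finE by (auto intro: finite_subset)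
    ultimately show ?case using SF xy y new reach
      by (intro exI[of _ "insert y S"] exI[of _ "insert {x, y} F"]) auto
  qed
  have pos: "card V > 0" using r finV card_gt_0_iff by blast
  then obtain S F where SF: "S \<subseteq> V" "F \<subseteq> E" "card S = card V" "card F + 1 = card V"
    "\<And>x. x \<in> S \<Longrightarrow> (r, x) \<in> (adj F)\<^sup>*"
    using grow[of "card V - 1"] by auto
  have "S = V" using card_subset_eq[OF finV SF(1,3)] .
  then have "connected_graph (V, F)" using SF(5) by (intro connected_graphI[OF r]) simp
  then show ?thesis using that SF(2,4) by simp
qed

lemma connected_card_edges:
  assumes "is_graph (V, E)" "connected_graph (V, E)"
  shows "card V \<le> card E + 1"
proof -
  obtain F where "F \<subseteq> E" "card F + 1 = card V"
    by (rule connected_spanning_subset[OF assms])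
  then show ?thesis using card_mono[OF is_graph_finite_edges[OF assms(1)], of F] by simp
qed

text \<open>In a tree, an edge outside a connected spanning \<open>F\<close> would be a chord and
  close a cycle, so \<open>E = F\<close>. Conversely, deleting an edge of a cycle would leave a
  connected graph with fewer than \<open>card V - 1\<close> edges.\<close>

lemma tree_iff_card:
  assumes "is_graph (V, E)"
  shows "tree (V, E) \<longleftrightarrow> connected_graph (V, E) \<and> card E + 1 = card V"
proof (intro iffI conjI)
  assume T: "tree (V, E)"
  then show con: "connected_graph (V, E)" by (simp add: tree_def)
  obtain F where F: "F \<subseteq> E" "connected_graph (V, F)" "card F + 1 = card V"
    using connected_spanning_subset[OF assms con] .
  have "E \<subseteq> F"
  proof
    fix e assume e: "e \<in> E"
    obtain u v where uv: "u \<in> V" "v \<in> V" "e = {u, v}"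
      using is_graph_edgeE[OF assms e] by blast
    show "e \<in> F"
      using chord_gives_cycle[OF assms F(1), of u v] connected_graphD[OF F(2) uv(1,2)] e uv(3) T
      unfolding tree_def by blast
  qed
  then show "card E + 1 = card V" using F by auto
next
  assume A: "connected_graph (V, E) \<and> card E + 1 = card V"
  have "\<not> graph_cycle (V, E) xs" for xs
  proof
    assume "graph_cycle (V, E) xs"
    then obtain e where e: "e \<in> E" "connected_graph (V, E - {e})"
      using cycle_edge_removable A by blast
    have "card V \<le> card (E - {e}) + 1"
      by (rule connected_card_edges[OF is_graph_subset[OF assms] e(2)]) auto
    moreover have "card (E - {e}) < card E"
      using e(1) is_graph_finite_edges[OF assms] by (intro psubset_card_mono) auto
    ultimately show False using A by simp
  qed
  then show "tree (V, E)" using A assms by (simp add: tree_def)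
qed

text \<open>With the vertex set fixed, a spanning tree is determined by its edges. The edge count
  stands in for acyclicity, so cycles need not be traced through the construction.\<close>

definition tree_edge_sets :: "'a ugraph \<Rightarrow> 'a set set set" where
  "tree_edge_sets G =
    {F. F \<subseteq> edges G \<and> connected_graph (verts G, F) \<and> card F + 1 = card (verts G)}"

lemma num_spanning_trees_eq_card:
  assumes "is_graph G"
  shows "num_spanning_trees G = card (tree_edge_sets G)"
proof -
  obtain V E where G: "G = (V, E)" by (cases G)
  have sub: "is_graph (V, F)" if "F \<subseteq> E" for F
    using is_graph_subset that assms G by auto
  have "{T. spanning_tree T G} = Pair V ` tree_edge_sets G"
  proof (intro equalityI subsetI)
    fix T assume "T \<in> {T. spanning_tree T G}"
    then obtain F where "T = (V, F)" "F \<subseteq> E" "tree (V, F)"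
      unfolding spanning_tree_def subgraph_def G by (cases T) auto
    then show "T \<in> Pair V ` tree_edge_sets G"
      using tree_iff_card[OF sub, of F] by (simp add: tree_edge_sets_def G)
  next
    fix T assume "T \<in> Pair V ` tree_edge_sets G"
    then obtain F where "T = (V, F)" "F \<subseteq> E" "connected_graph (V, F)" "card F + 1 = card V"
      by (auto simp: tree_edge_sets_def G)
    then show "T \<in> {T. spanning_tree T G}"
      using tree_iff_card[OF sub, of F] sub[of F] assms
      by (simp add: G spanning_tree_def subgraph_def)
  qed
  then show ?thesis unfolding num_spanning_trees_def
    by (simp add: card_image inj_on_def)
qed

section \<open>Erecting a triangle on every edge\<close>

text \<open>One growth step in isolation, with \<open>w e\<close> as the apex over the edge
  \<open>e\<close>. Injectivity and freshness keep the triangles edge-disjoint, so that edge sets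
  can be counted triangle by triangle.\<close>

locale triangulation =
  fixes V :: "'a set" and E :: "'a set set" and w :: "'a set \<Rightarrow> 'a"
  assumes graph: "is_graph (V, E)"
    and inj_w: "inj_on w E"
    and fresh: "e \<in> E \<Longrightarrow> w e \<notin> V"
begin

definition star :: "'a set \<Rightarrow> 'a set set" where
  "star e = (\<lambda>x. {x, w e}) ` e"

definition block :: "'a set \<Rightarrow> 'a set set" where
  "block e = insert e (star e)"

definition V' :: "'a set" where "V' = V \<union> w ` E"

definition E' :: "'a set set" where "E' = E \<union> (\<Union>e\<in>E. star e)"

definition project :: "'a set set \<Rightarrow> 'a set set" where
  "project F = {e \<in> E. e \<in> F \<or> star e \<subseteq> F}"

lemma E'_eq: "E' = (\<Union>e\<in>E. block e)"
  by (auto simp: E'_def block_def)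

lemma edge_subset: "e \<in> E \<Longrightarrow> e \<subseteq> V"
  by (erule is_graph_edgeE[OF graph]) simp

lemma finites: "finite V" "finite E"
  using graph is_graph_finite_edges[OF graph] by (auto simp: is_graph_def)

lemma star_notin_E: "s \<in> star e \<Longrightarrow> e \<in> E \<Longrightarrow> s \<notin> E"
  using edge_subset[of s] fresh[of e] by (auto simp: star_def)

text \<open>The apex is the only vertex of a star edge outside \<open>V\<close>, so the edge
  determines the apex and hence the edge below it.\<close>

lemma star_disjoint: "s \<in> star e \<Longrightarrow> s \<in> star f \<Longrightarrow> e \<in> E \<Longrightarrow> f \<in> E \<Longrightarrow> e = f"
proof -
  assume *: "s \<in> star e" "s \<in> star f" and ef: "e \<in> E" "f \<in> E"
  then have "w e \<in> insert (w f) f" by (auto simp: star_def doubleton_eq_iff)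
  then have "w e = w f" using edge_subset[OF ef(2)] fresh[OF ef(1)] by auto
  then show ?thesis using inj_w ef by (auto simp: inj_on_def)
qed

lemma block_disjoint:
  assumes "e \<in> E" "f \<in> E" "e \<noteq> f"
  shows "block e \<inter> block f = {}"
  using assms star_notin_E[of _ e] star_notin_E[of _ f] star_disjoint[of _ e f]
  by (auto simp: block_def)

lemma block_structure:
  assumes "e \<in> E"
  obtains s t where "star e = {s, t}" "s \<noteq> t" "e \<noteq> s" "e \<noteq> t"
proof -
  obtain u v where uv: "u \<in> V" "v \<in> V" "u \<noteq> v" "e = {u, v}"
    using is_graph_edgeE[OF graph assms] .
  have "star e = {{u, w e}, {v, w e}}" using uv(4) by (simp add: star_def)
  moreover have "{u, w e} \<noteq> {v, w e}" using uv(3) by (auto simp: doubleton_eq_iff)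
  moreover have "e \<notin> star e" using star_notin_E[OF _ assms] assms by auto
  ultimately show ?thesis using that by simp
qed

lemma card_block: "e \<in> E \<Longrightarrow> card (block e) = 3"
  by (rule block_structure[of e]) (simp_all add: block_def)

lemma finite_block: "e \<in> E \<Longrightarrow> finite (block e)"
  using card_block by (intro card_ge_0_finite) simp

lemma card_V': "card V' = card V + card E"
proof -
  have "V \<inter> w ` E = {}" using fresh by auto
  then show ?thesis unfolding V'_def
    using finites by (simp add: card_Un_disjoint card_image inj_w)
qed

lemma card_subset_blocks:
  assumes "F \<subseteq> E'"
  shows "card F = (\<Sum>e\<in>E. card (F \<inter> block e))"
proof -
  have "F = (\<Union>e\<in>E. F \<inter> block e)" using assms E'_eq by auto
  also have "card \<dots> = (\<Sum>e\<in>E. card (F \<inter> block e))"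
  proof (rule card_UN_disjoint[OF finites(2)])
    show "\<forall>e\<in>E. finite (F \<inter> block e)"
      using finite_block by simp
    show "\<forall>e\<in>E. \<forall>f\<in>E. e \<noteq> f \<longrightarrow> F \<inter> block e \<inter> (F \<inter> block f) = {}"
      using block_disjoint by blast
  qed
  finally show ?thesis .
qed

lemma card_E': "card E' = 3 * card E"
proof -
  have "card (E' \<inter> block e) = 3" if "e \<in> E" for e
  proof -
    have "E' \<inter> block e = block e" using that E'_eq by auto
    then show ?thesis using card_block[OF that] by simp
  qed
  then show ?thesis using card_subset_blocks[of E'] by simp
qed

text \<open>A walk that passes through an apex from one endpoint of \<open>e\<close> to the other
  uses both star edges, so \<open>e\<close> is in \<open>project F\<close> and serves as a shortcut.
  Conversely, a projected edge is either present or replaced by the detour over its apex, and each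
  apex hangs on some star edge.\<close>

lemma connected_lift:
  assumes V: "V \<noteq> {}" and F: "F \<subseteq> E'"
  shows "connected_graph (V', F) \<longleftrightarrow>
    connected_graph (V, project F) \<and> (\<forall>e\<in>E. F \<inter> star e \<noteq> {})"
proof (intro iffI conjI ballI)
  assume con: "connected_graph (V', F)"
  obtain r where r: "r \<in> V" using V by auto
  have edge_cases: "{y, z} \<in> E \<or> (\<exists>e\<in>E. y \<in> e \<and> z = w e \<or> z \<in> e \<and> y = w e)"
    if "{y, z} \<in> F" for y z
    using that F unfolding E'_def star_def by (fastforce simp: doubleton_eq_iff)
  \<comment> \<open>An induction along the walk must also cover walks that stop at an apex. For
    these it records that every endpoint joined to that apex by \<open>F\<close> is reachable, which
    is what the step back into \<open>V\<close> requires.\<close>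
  have inv: "(y \<in> V \<longrightarrow> (r, y) \<in> (adj (project F))\<^sup>*) \<and>
      (\<forall>e\<in>E. \<forall>x\<in>e. y = w e \<longrightarrow> {x, w e} \<in> F \<longrightarrow> (r, x) \<in> (adj (project F))\<^sup>*)"
    if "(r, y) \<in> (adj F)\<^sup>*" for y
    using that
  proof (induction rule: rtrancl_induct)
    case base
    show ?case using r fresh by auto
  next
    case (step y z)
    then have yz: "{y, z} \<in> F" by simp
    consider "{y, z} \<in> E" | e where "e \<in> E" "y \<in> e" "z = w e"
      | e where "e \<in> E" "z \<in> e" "y = w e"
      using edge_cases[OF yz] by auto
    then show ?case
    proof cases
      case 1
      then have "{y, z} \<in> project F" using yz by (simp add: project_def)
      moreover have "y \<in> V" "z \<in> V" using edge_subset[OF 1] by auto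
      ultimately show ?thesis using step(3) fresh
        by (auto intro: rtrancl_into_rtrancl)
    next
      case (2 e)
      have y: "y \<in> V" "z \<notin> V" using 2 edge_subset fresh by auto
      have ry: "(r, y) \<in> (adj (project F))\<^sup>*" using step(3) y by simp
      have "(r, x) \<in> (adj (project F))\<^sup>*" if "f \<in> E" "x \<in> f" "z = w f" "{x, w f} \<in> F" for f x
      \<comment> \<open>Besides \<open>y\<close>, only the other endpoint of \<open>e\<close> can be
        \<open>x\<close>; then both star edges are in \<open>F\<close> and \<open>e\<close> is
        projected.\<close>
      proof (cases "x = y")
        case True
        then show ?thesis using ry by simp
      next
        case False
        have "f = e" using that 2 inj_w by (auto simp: inj_on_def)
        then have e: "e = {y, x}"
          using False that(2) 2(1,2) by (auto elim!: is_graph_edgeE[OF graph])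
        then have "star e \<subseteq> F" using that(4) yz 2(3) \<open>f = e\<close> by (auto simp: star_def)
        then have "{y, x} \<in> project F" using e 2(1) by (simp add: project_def)
        then show ?thesis using ry by (auto intro: rtrancl_into_rtrancl)
      qed
      then show ?thesis using y by blast
    next
      case (3 e)
      have "z \<in> V" using 3 edge_subset by auto
      moreover have "(r, z) \<in> (adj (project F))\<^sup>*"
        using step(3) 3 yz by (auto simp: insert_commute)
      ultimately show ?thesis using fresh by auto
    qed
  qed
  show "connected_graph (V, project F)"
  proof (rule connected_graphI[OF r])
    fix v assume v: "v \<in> V"
    have "(r, v) \<in> (adj F)\<^sup>*" using connected_graphD[OF con, of r v] r v by (simp add: V'_def)
    then show "(r, v) \<in> (adj (project F))\<^sup>*" using inv[of v] v by simp
  qed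
  fix e assume e: "e \<in> E"
  \<comment> \<open>The walk from \<open>r\<close> to the apex is nonempty and therefore has a last
    edge. Freshness and injectivity leave only the star edges of \<open>e\<close> for it.\<close>
  have "(r, w e) \<in> (adj F)\<^sup>*" using connected_graphD[OF con, of r "w e"] r e by (simp add: V'_def)
  moreover have "r \<noteq> w e" using fresh[OF e] r by auto
  ultimately obtain y where "{y, w e} \<in> F" by (auto elim: rtranclE)
  moreover have "y \<in> e"
    using edge_cases[OF \<open>{y, w e} \<in> F\<close>]
  proof
    assume "{y, w e} \<in> E"
    then show ?thesis using edge_subset fresh[OF e] by auto
  next
    assume "\<exists>f\<in>E. y \<in> f \<and> w e = w f \<or> w e \<in> f \<and> y = w f"
    then show ?thesis using edge_subset fresh[OF e] inj_w e by (auto simp: inj_on_def)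
  qed
  ultimately show "F \<inter> star e \<noteq> {}" by (auto simp: star_def)
next
  assume A: "connected_graph (V, project F) \<and> (\<forall>e\<in>E. F \<inter> star e \<noteq> {})"
  obtain r where r: "r \<in> V" using V by auto
  have "connected_graph (V, F)"
  proof (rule connected_graph_transfer[of _ "project F"])
    fix x y assume xy: "{x, y} \<in> project F"
    then consider "{x, y} \<in> F" | "star {x, y} \<subseteq> F" by (auto simp: project_def)
    then show "(x, y) \<in> (adj F)\<^sup>*"
    proof cases
      case 2
      then have "(x, w {x, y}) \<in> adj F" "(w {x, y}, y) \<in> adj F"
        by (auto simp: star_def insert_commute)
      then show ?thesis by (meson r_into_rtrancl rtrancl_into_rtrancl)
    qed auto
  qed (use A in simp)
  then have rV: "(r, v) \<in> (adj F)\<^sup>*" if "v \<in> V" for v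
    using connected_graphD r that by metis
  have "(r, w e) \<in> (adj F)\<^sup>*" if "e \<in> E" for e
  proof -
    have "F \<inter> star e \<noteq> {}" using A that by blast
    then obtain x where x: "x \<in> e" "{x, w e} \<in> F" by (auto simp: star_def)
    have "(r, x) \<in> (adj F)\<^sup>*" using rV edge_subset[OF that] x(1) by blast
    then show ?thesis by (rule rtrancl_into_rtrancl) (simp add: x(2))
  qed
  then show "connected_graph (V', F)"
    using rV r by (intro connected_graphI[of r V']) (auto simp: V'_def)
qed

text \<open>A triangle with at least one star edge in \<open>F\<close> contributes one edge, a
  second if \<open>F\<close> joins the endpoints within it, and a third if it lies wholly in
  \<open>F\<close>.\<close>

lemma card_project:
  assumes F: "F \<subseteq> E'" and ne: "\<And>e. e \<in> E \<Longrightarrow> F \<inter> star e \<noteq> {}"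
  shows "card F = card E + card (project F) + card {e \<in> E. block e \<subseteq> F}"
proof -
  have "card (F \<inter> block e) = 1 + (if e \<in> project F then 1 else 0) + (if block e \<subseteq> F then 1 else 0)"
    if e: "e \<in> E" for e
  proof -
    obtain s t where st: "star e = {s, t}" "s \<noteq> t" "e \<noteq> s" "e \<noteq> t"
      using block_structure[OF e] .
    then show ?thesis using ne[OF e] e
      by (cases "e \<in> F"; cases "s \<in> F"; cases "t \<in> F") (simp_all add: block_def project_def)
  qed
  then have "card F = (\<Sum>e\<in>E. 1 + (if e \<in> project F then 1 else 0)
      + (if block e \<subseteq> F then 1 else 0))"
    using card_subset_blocks[OF F] by simp
  also have "\<dots> = card E + card (E \<inter> project F) + card (E \<inter> {e. block e \<subseteq> F})"
    unfolding sum.distrib using finites by (simp add: sum.If_cases)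
  also have "E \<inter> project F = project F" by (auto simp: project_def)
  finally show ?thesis by (simp add: Int_def)
qed

text \<open>
  The possible intersections of a spanning tree with the triangle on an edge \<open>e\<close>, according to
  whether they connect the endpoints of \<open>e\<close>.
\<close>

definition states :: "bool \<Rightarrow> 'a set \<Rightarrow> 'a set set set" where
  "states c e = (if c then insert (star e) ((\<lambda>s. {e, s}) ` star e) else (\<lambda>s. {s}) ` star e)"

text \<open>Over a spanning tree \<open>F0\<close> this will be the set of spanning trees of
  \<open>(V', E')\<close> that \<open>project\<close> sends to \<open>F0\<close>. The triangle-wise
  form makes it a product over \<open>E\<close>.\<close>

definition fibre :: "'a set set \<Rightarrow> 'a set set set" where
  "fibre F0 = {F. F \<subseteq> E' \<and> (\<forall>e\<in>E. F \<inter> block e \<in> states (e \<in> F0) e)}"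

lemma card_states:
  assumes "e \<in> E"
  shows "card (states c e) = (if c then 3 else 2)"
proof -
  obtain s t where st: "star e = {s, t}" "s \<noteq> t" "e \<noteq> s" "e \<noteq> t"
    using block_structure[OF assms] .
  then have "{s, t} \<noteq> {e, s}" "{s, t} \<noteq> {e, t}" "{e, s} \<noteq> {e, t}" by (auto simp: doubleton_eq_iff)
  then show ?thesis using st by (simp add: states_def)
qed

text \<open>Of the eight subsets of a triangle, two miss the star and one is the whole triangle. The
  remaining five split into three that join the endpoints of \<open>e\<close> and two that do
  not.\<close>

lemma states_iff:
  assumes "e \<in> E"
  shows "F \<inter> block e \<in> states c e \<longleftrightarrow>
    F \<inter> star e \<noteq> {} \<and> \<not> block e \<subseteq> F \<and> (c \<longleftrightarrow> e \<in> project F)"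
proof -
  obtain s t where st: "star e = {s, t}" "s \<noteq> t" "e \<noteq> s" "e \<noteq> t"
    using block_structure[OF assms] .
  moreover have "{e, s, t} \<noteq> {s, t}" "{e, s, t} \<noteq> {e, s}" "{e, s, t} \<noteq> {e, t}"
    using st by blast+
  ultimately show ?thesis using assms
    by (cases c; cases "e \<in> F"; cases "s \<in> F"; cases "t \<in> F")
      (simp_all add: states_def block_def project_def doubleton_eq_iff)
qed

lemma states_subset_block: "S \<in> states c e \<Longrightarrow> S \<subseteq> block e"
  by (auto simp: states_def block_def split: if_splits)

text \<open>The triangles are disjoint and cover \<open>E'\<close>, so a member of the fibre is an
  independent choice of a state in each triangle, and the union of the choices recovers it.\<close>

lemma card_fibre:
  assumes "F0 \<subseteq> E"
  shows "card (fibre F0) = 3 ^ card F0 * 2 ^ (card E - card F0)"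
proof -
  let ?P = "Pi\<^sub>E E (\<lambda>e. states (e \<in> F0) e)"
  have "bij_betw (\<lambda>F. \<lambda>e\<in>E. F \<inter> block e) (fibre F0) ?P"
  proof (rule bij_betw_byWitness[where f' = "\<lambda>g. \<Union>e\<in>E. g e"])
    show "\<forall>F\<in>fibre F0. (\<Union>e\<in>E. (\<lambda>e\<in>E. F \<inter> block e) e) = F"
      by (auto simp: fibre_def E'_eq)
    have blk: "(\<Union>f\<in>E. g f) \<inter> block e = g e" if g: "g \<in> ?P" and e: "e \<in> E" for g e
    proof -
      have "g f \<subseteq> block f" if "f \<in> E" for f
        using states_subset_block PiE_mem[OF g that] by blast
      then show ?thesis using block_disjoint e by blast
    qed
    then show "\<forall>g\<in>?P. (\<lambda>e\<in>E. (\<Union>e\<in>E. g e) \<inter> block e) = g"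
      by (auto intro!: PiE_ext[of _ E "\<lambda>e. states (e \<in> F0) e"] simp: PiE_mem)
    show "(\<lambda>F. \<lambda>e\<in>E. F \<inter> block e) ` fibre F0 \<subseteq> ?P"
      by (auto simp: fibre_def)
    show "(\<lambda>g. \<Union>e\<in>E. g e) ` ?P \<subseteq> fibre F0"
    proof (intro subsetI, elim imageE, hypsubst)
      fix g assume g: "g \<in> ?P"
      have "(\<Union>e\<in>E. g e) \<subseteq> E'"
        using states_subset_block PiE_mem[OF g] unfolding E'_eq by blast
      then show "(\<Union>e\<in>E. g e) \<in> fibre F0"
        using blk[OF g] PiE_mem[OF g] by (simp add: fibre_def)
    qed
  qed
  then have "card (fibre F0) = card ?P" by (rule bij_betw_same_card)
  also have "\<dots> = (\<Prod>e\<in>E. if e \<in> F0 then 3 else 2)"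
    using finites card_states by (simp add: card_PiE)
  also have "\<dots> = 3 ^ card (E \<inter> F0) * 2 ^ card (E - F0)"
    using finites by (simp add: prod.If_cases Diff_eq)
  also have "E \<inter> F0 = F0" using assms by auto
  also have "card (E - F0) = card E - card F0"
    using assms finites by (simp add: card_Diff_subset finite_subset)
  finally show ?thesis .
qed

lemma tree_edge_sets_fibres:
  assumes "V \<noteq> {}"
  shows "tree_edge_sets (V', E') = (\<Union>F0\<in>tree_edge_sets (V, E). fibre F0)"
proof -
  have iff: "F \<in> tree_edge_sets (V', E') \<longleftrightarrow>
      F \<subseteq> E' \<and> project F \<in> tree_edge_sets (V, E) \<and> (\<forall>e\<in>E. F \<inter> star e \<noteq> {} \<and> \<not> block e \<subseteq> F)" for F
  proof (cases "F \<subseteq> E' \<and> connected_graph (V, project F) \<and> (\<forall>e\<in>E. F \<inter> star e \<noteq> {})")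
    case True
    have sub: "project F \<subseteq> E" by (auto simp: project_def)
    have "card V \<le> card (project F) + 1"
      using True by (intro connected_card_edges is_graph_subset[OF graph sub]) auto
    moreover have "card F = card E + card (project F) + card {e \<in> E. block e \<subseteq> F}"
      using True by (intro card_project) auto
    moreover have "card {e \<in> E. block e \<subseteq> F} = 0 \<longleftrightarrow> (\<forall>e\<in>E. \<not> block e \<subseteq> F)"
      using finites by auto
    \<comment> \<open>Since \<open>project F\<close> is connected, it has at least
      \<open>card V - 1\<close> edges. So \<open>F\<close> reaches the minimal count only if
      \<open>project F\<close> is itself minimal and no triangle is full.\<close>
    ultimately have "card F + 1 = card V' \<longleftrightarrow>
        card (project F) + 1 = card V \<and> (\<forall>e\<in>E. \<not> block e \<subseteq> F)"
      unfolding card_V' by linarith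
    then show ?thesis using True sub connected_lift[OF assms, of F]
      by (simp add: tree_edge_sets_def)
  next
    case False
    then show ?thesis using connected_lift[OF assms, of F] by (simp add: tree_edge_sets_def) blast
  qed
  have fib: "F \<in> fibre F0 \<longleftrightarrow>
      F \<subseteq> E' \<and> (\<forall>e\<in>E. F \<inter> star e \<noteq> {} \<and> \<not> block e \<subseteq> F) \<and> project F = F0"
    if "F0 \<in> tree_edge_sets (V, E)" for F F0
  proof -
    \<comment> \<open>The states test membership in \<open>F0\<close> only on edges of
      \<open>E\<close>; as both sets lie in \<open>E\<close>, agreement there is equality.\<close>
    have "F0 \<subseteq> E" using that by (simp add: tree_edge_sets_def)
    then have "(\<forall>e\<in>E. e \<in> F0 \<longleftrightarrow> e \<in> project F) \<longleftrightarrow> project F = F0"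
      by (auto simp: project_def)
    then show ?thesis by (simp add: fibre_def states_iff) blast
  qed
  show ?thesis
  proof (rule set_eqI)
    fix F
    have "(\<exists>F0\<in>tree_edge_sets (V, E). F \<in> fibre F0) \<longleftrightarrow> (\<exists>F0\<in>tree_edge_sets (V, E).
        F \<subseteq> E' \<and> (\<forall>e\<in>E. F \<inter> star e \<noteq> {} \<and> \<not> block e \<subseteq> F) \<and> project F = F0)"
      using fib by (intro bex_cong refl)
    then show "F \<in> tree_edge_sets (V', E') \<longleftrightarrow> F \<in> (\<Union>F0\<in>tree_edge_sets (V, E). fibre F0)"
      unfolding iff UN_iff by blast
  qed
qed

text \<open>The fibres are pairwise disjoint, and all have the same size because every spanning tree
  of \<open>(V, E)\<close> has \<open>card V - 1\<close> edges.\<close>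

lemma card_tree_edge_sets:
  assumes "V \<noteq> {}"
  shows "card (tree_edge_sets (V', E')) =
    3 ^ (card V - 1) * 2 ^ (card E + 1 - card V) * card (tree_edge_sets (V, E))"
proof -
  let ?T = "tree_edge_sets (V, E)"
  have sub: "F0 \<subseteq> E" and card: "card F0 + 1 = card V" if "F0 \<in> ?T" for F0
    using that by (auto simp: tree_edge_sets_def)
  have "?T \<subseteq> Pow E" using sub by auto
  then have fin: "finite ?T" by (rule finite_subset) (simp add: finites)
  have "fibre F0 \<subseteq> Pow E'" for F0 by (auto simp: fibre_def)
  moreover have "finite (Pow E')"
    unfolding E'_eq using finites finite_block by simp
  ultimately have fib: "finite (fibre F0)" for F0 by (rule finite_subset)
  have disj: "fibre F0 \<inter> fibre F1 = {}" if F: "F0 \<in> ?T" "F1 \<in> ?T" "F0 \<noteq> F1" for F0 F1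
  proof -
    obtain e where "e \<in> E" "(e \<in> F0) \<noteq> (e \<in> F1)"
      using sub[OF F(1)] sub[OF F(2)] F(3) by blast
    then show ?thesis by (auto simp: fibre_def states_iff)
  qed
  have "card (tree_edge_sets (V', E')) = (\<Sum>F0\<in>?T. card (fibre F0))"
    unfolding tree_edge_sets_fibres[OF assms]
    by (intro card_UN_disjoint ballI impI fin fib disj)
  also have "\<dots> = (\<Sum>F0\<in>?T. 3 ^ (card V - 1) * 2 ^ (card E + 1 - card V))"
  proof (rule sum.cong[OF refl])
    fix F0 assume F0: "F0 \<in> ?T"
    have "card V - 1 = card F0" "card E + 1 - card V = card E - card F0"
      using card[OF F0] by auto
    then show "card (fibre F0) = 3 ^ (card V - 1) * 2 ^ (card E + 1 - card V)"
      using card_fibre[OF sub[OF F0]] by simp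
  qed
  finally show ?thesis by simp
qed

end

section \<open>The web as an iterated triangulation\<close>

text \<open>\<open>Abs_fset\<close> turns an edge into the label of its apex. It is injective on
  finite sets, hence on edges.\<close>

lemma pseudofractal_triangulation:
  fixes n :: nat
  defines "w \<equiv> \<lambda>e. New n (Abs_fset e)"
  defines "V \<equiv> verts (pseudofractal n)" and "E \<equiv> edges (pseudofractal n)"
  shows "triangulation V E w"
    and "pseudofractal (Suc n) = (triangulation.V' V E w, triangulation.E' E w)"
proof -
  have graph: "is_graph (V, E)" using is_graph_pseudofractal by (simp add: V_def E_def)
  have fin: "finite e" if "e \<in> E" for e
    by (rule is_graph_edgeE[OF graph that]) simp
  show tri: "triangulation V E w"
  proof
    show "is_graph (V, E)" by (rule graph)
    show "inj_on w E"
      using fin by (auto simp: inj_on_def w_def Abs_fset_inject)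
    show "w e \<notin> V" if "e \<in> E" for e
      using New_fresh by (simp add: w_def V_def)
  qed
  have w: "w {u, v} = New n {|u, v|}" for u v
    using fset_inverse[of "{|u, v|}"] by (simp add: w_def)
  have ex: "\<exists>u v. e = {u, v}" if "e \<in> E" for e
    by (rule is_graph_edgeE[OF graph that]) blast
  have "w ` E = {New n {|u, v|} | u v. {u, v} \<in> E}"
    unfolding w[symmetric]
  proof (intro equalityI subsetI)
    fix x assume "x \<in> w ` E"
    then obtain e where e: "e \<in> E" "x = w e" by auto
    obtain u v where "e = {u, v}" using ex[OF e(1)] by blast
    then show "x \<in> {w {u, v} | u v. {u, v} \<in> E}" using e by blast
  qed blast
  moreover have "(\<Union>e\<in>E. triangulation.star w e) = {{u, New n {|u, v|}} | u v. {u, v} \<in> E}"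
    unfolding triangulation.star_def[OF tri] w[symmetric]
  proof (intro equalityI subsetI)
    fix s assume "s \<in> (\<Union>e\<in>E. (\<lambda>x. {x, w e}) ` e)"
    then obtain e x where s: "e \<in> E" "x \<in> e" "s = {x, w e}" by blast
    obtain a b where "e = {a, b}" using ex[OF s(1)] by blast
    \<comment> \<open>The comprehension names the endpoint on the new edge first, so
      \<open>e\<close> is rewritten with \<open>x\<close> in front.\<close>
    then have "e = {x, a} \<or> e = {x, b}" using s(2) by auto
    then obtain y where "e = {x, y}" by blast
    then show "s \<in> {{u, w {u, v}} | u v. {u, v} \<in> E}" using s(1,3) by blast
  qed blast
  ultimately show "pseudofractal (Suc n) = (triangulation.V' V E w, triangulation.E' E w)"
    unfolding triangulation.V'_def[OF tri] triangulation.E'_def[OF tri]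
    by (simp add: V_def E_def)
qed

lemma card_edges_pseudofractal: "card (edges (pseudofractal n)) = 3 ^ (n + 1)"
proof (induction n)
  case 0
  show ?case by (simp add: doubleton_eq_iff)
next
  case (Suc n)
  then show ?case
    using triangulation.card_E'[OF pseudofractal_triangulation(1)[of n]]
    unfolding pseudofractal_triangulation(2) by simp
qed

text \<open>Each step adds one vertex for each of the \<open>3 ^ (n + 1)\<close> edges. The doubled
  form avoids division in the naturals.\<close>

lemma card_verts_pseudofractal: "2 * card (verts (pseudofractal n)) = 3 ^ (n + 1) + 3"
proof (induction n)
  case 0
  show ?case by simp
next
  case (Suc n)
  then show ?case
    using triangulation.card_V'[OF pseudofractal_triangulation(1)[of n]]
      card_edges_pseudofractal[of n]
    unfolding pseudofractal_triangulation(2) by simp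
qed

lemma connected_graph_path3:
  assumes "{a, b} \<in> F" "{b, c} \<in> F"
  shows "connected_graph ({a, b, c}, F)"
proof (rule connected_graphI[of b])
  fix v assume "v \<in> {a, b, c}"
  moreover have "(b, a) \<in> adj F" "(b, c) \<in> adj F"
    using assms by (simp_all add: insert_commute)
  ultimately show "(b, v) \<in> (adj F)\<^sup>*" by blast
qed simp

lemma two_of_three:
  assumes "F \<subseteq> {p, q, r}" "card F = 2"
  shows "p \<in> F \<and> q \<in> F \<or> q \<in> F \<and> r \<in> F \<or> r \<in> F \<and> p \<in> F"
  using assms by (auto simp: card_2_iff)

text \<open>Any two edges of a triangle form a path through all three vertices, so the spanning
  trees are the 2-subsets of its three edges.\<close>

lemma num_spanning_trees_pseudofractal_0: "num_spanning_trees (pseudofractal 0) = 3"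
proof -
  let ?V = "{TriA, TriB, TriC}"
  let ?E = "{{TriA, TriB}, {TriB, TriC}, {TriA, TriC}}"
  have E3: "card ?E = 3" by (simp add: doubleton_eq_iff)
  have con: "connected_graph (?V, F)" if F: "F \<subseteq> ?E" "card F = 2" for F
  proof -
    consider "{TriA, TriB} \<in> F" "{TriB, TriC} \<in> F" | "{TriB, TriC} \<in> F" "{TriC, TriA} \<in> F"
      | "{TriC, TriA} \<in> F" "{TriA, TriB} \<in> F"
      using two_of_three[OF F] by (auto simp: insert_commute[of TriC])
    then show ?thesis
    proof cases
      case 1
      then show ?thesis by (rule connected_graph_path3)
    next
      case 2
      from connected_graph_path3[OF this] show ?thesis by (simp only: insert_commute)
    next
      case 3
      from connected_graph_path3[OF this] show ?thesis by (simp only: insert_commute)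
    qed
  qed
  have "tree_edge_sets (pseudofractal 0) = {F. F \<subseteq> ?E \<and> card F = 2}"
    unfolding tree_edge_sets_def using con by fastforce
  then show ?thesis
    using n_subsets[of ?E 2] E3
    by (simp add: num_spanning_trees_eq_card is_graph_pseudofractal choose_two
        del: pseudofractal.simps)
qed

lemma num_spanning_trees_pseudofractal_Suc:
  "num_spanning_trees (pseudofractal (Suc n)) =
    3 ^ (card (verts (pseudofractal n)) - 1) *
    2 ^ (card (edges (pseudofractal n)) + 1 - card (verts (pseudofractal n))) *
    num_spanning_trees (pseudofractal n)"
proof -
  have "verts (pseudofractal n) \<noteq> {}"
    using card_verts_pseudofractal[of n] by auto
  from triangulation.card_tree_edge_sets[OF pseudofractal_triangulation(1) this]
  show ?thesis
    unfolding num_spanning_trees_eq_card[OF is_graph_pseudofractal]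
    unfolding pseudofractal_triangulation(2) by simp
qed

theorem theorem4:
  fixes n :: nat
  shows "real (num_spanning_trees (pseudofractal n)) =
    2 powr ((3 ^ (n + 1) - 2 * real n - 3) / 4) * 3 powr ((3 ^ (n + 1) + 2 * real n + 1) / 4)"
proof (induction n)
  case 0
  show ?case using num_spanning_trees_pseudofractal_0 by simp
next
  case (Suc n)
  let ?v = "card (verts (pseudofractal n))" and ?e = "card (edges (pseudofractal n))"
  have v: "real ?v = (3 ^ (n + 1) + 3) / 2"
    using arg_cong[OF card_verts_pseudofractal[of n], of real] by simp
  have e: "real ?e = 3 ^ (n + 1)"
    using card_edges_pseudofractal[of n] by simp
  \<comment> \<open>These bounds rule out truncation in the two natural-number exponents, so they
    can be computed in the reals.\<close>
  have "1 \<le> ?v" "?v \<le> ?e + 1"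
    using card_verts_pseudofractal[of n] card_edges_pseudofractal[of n]
      one_le_power[of "3::nat" n] by auto
  then have ex: "real (?v - 1) = (3 ^ (n + 1) + 1) / 2"
    "real (?e + 1 - ?v) = (3 ^ (n + 1) - 1) / 2"
    using v e by (auto simp: of_nat_diff field_simps)
  have "real (num_spanning_trees (pseudofractal (Suc n))) =
      3 powr real (?v - 1) * 2 powr real (?e + 1 - ?v) *
      real (num_spanning_trees (pseudofractal n))"
    unfolding num_spanning_trees_pseudofractal_Suc by (simp add: powr_realpow)
  also have "\<dots> =
      2 powr ((3 ^ (n + 1) - 1) / 2 + (3 ^ (n + 1) - 2 * real n - 3) / 4) *
      3 powr ((3 ^ (n + 1) + 1) / 2 + (3 ^ (n + 1) + 2 * real n + 1) / 4)"
    unfolding Suc.IH ex powr_add by (simp add: mult_ac)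
  \<comment> \<open>Over the denominator 4 the recursion adds \<open>2 * 3 ^ (n + 1)\<close> to both
    numerators, which makes \<open>3 ^ (n + 2)\<close>. The remaining -2 and +2 account for the
    change in the terms linear in \<open>n\<close>.\<close>
  also have "(3 ^ (n + 1) - 1) / 2 + (3 ^ (n + 1) - 2 * real n - 3) / 4 =
      (3 ^ (Suc n + 1) - 2 * real (Suc n) - 3) / 4"
    by (simp add: field_simps)
  also have "(3 ^ (n + 1) + 1) / 2 + (3 ^ (n + 1) + 2 * real n + 1) / 4 =
      (3 ^ (Suc n + 1) + 2 * real (Suc n) + 1) / 4"
    by (simp add: field_simps)
  finally show ?case .
qed

end
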